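(* Let $p\in(0,1]$, $L>0$ and $\alpha>\beta>0$. Let $\Pi$ be the prior on $f=(f_k)_{k\ge1}$ under which $f_k=\sigma_k\zeta_k$, with $\sigma_k=k^{-1/2-\alpha}$ and $(\zeta_k)_{k\ge1}$ i.i.d. with density $h_p(t)\propto\exp(-|t|^p/p)$, $t\in\mathbb R$. Let $\varepsilon_n=n^{-\frac{\beta}{2\beta+p(\alpha-\beta)+1}}$. Then there exists a function $f_0\in\mathcal F^\beta(L)$ such that, if $X=X^{(n)}\sim P_{f_0}^{(n)}$ is generated from the Gaussian sequence model, then for any $\rho\in(0,1]$, for a small enough constant $m>0$, as $n\to\infty$, $$E_{f_0}\Pi_\rho\big[\,\|f-f_0\|_2< m\,\varepsilon_n\,\big|\,X\big]\to0 .$$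
   Context: Gaussian sequence model: functions $f\in L^2[0,1]$ are identified with their coefficient sequences $(f_k)_{k\ge1}$ in a fixed orthonormal basis of $L^2[0,1]$, so $\|f\|_2^2=\sum_k f_k^2$. For $n\ge1$, $P_f^{(n)}$ is the law of $X=(X_k)_{k\ge1}$ with $X_k=f_k+n^{-1/2}\xi_k$, $\xi_k$ i.i.d. $\mathcal N(0,1)$. $E_{f_0}$ is expectation under $P_{f_0}^{(n)}$. $\rho$-posterior: for a prior $\Pi$ and $\rho\in(0,1]$, $\Pi_\rho[B\mid X]=\int_B e^{\rho\ell_n(f,X)}d\Pi(f)\big/\int e^{\rho\ell_n(f,X)}d\Pi(f)$, where $\ell_n(f,X)=-\frac n2\sum_k(X_k-f_k)^2$, understood up to an additive term not depending on $f$, i.e. as $n\sum_k X_kf_k-\frac n2\sum_k f_k^2$ (log-density with respect to $P_0^{(n)}$). For $\rho=1$ this is the usual posterior. Hyperrectangle: $\mathcal F^\beta(L)=\{f=(f_k):\ \max_{k\ge1}|f_k|k^{\beta+1/2}\le L\}$. *)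

theory Defs
  imports "HOL-Probability.Probability"
begin

text \<open>
  An element of \<open>L\<^sup>2[0,1]\<close> is identified with its coefficient sequence.  Sequences are indexed
  from 0, so that index \<open>k\<close> here carries the coefficient number \<open>Suc k\<close>.
\<close>

definition ell2 :: "(nat \<Rightarrow> real) set" where
  "ell2 = {f. summable (\<lambda>k. (f k)\<^sup>2)}"

definition ell2_norm :: "(nat \<Rightarrow> real) \<Rightarrow> real" where
  "ell2_norm f = sqrt (\<Sum>k. (f k)\<^sup>2)"

definition hyperrectangle :: "real \<Rightarrow> real \<Rightarrow> (nat \<Rightarrow> real) set" where
  "hyperrectangle \<beta> L = {f \<in> ell2. \<forall>k. \<bar>f k\<bar> * real (Suc k) powr (\<beta> + 1/2) \<le> L}"

definition gauss_seq :: "nat \<Rightarrow> (nat \<Rightarrow> real) \<Rightarrow> (nat \<Rightarrow> real) measure" where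
  "gauss_seq n f =
     distr (PiM UNIV (\<lambda>_. density lborel (\<lambda>x. ennreal (std_normal_density x)))) (PiM UNIV (\<lambda>_. borel))
       (\<lambda>\<xi> k. f k + \<xi> k / sqrt (real n))"

text \<open>
  Log-density of \<open>gauss_seq n f\<close> with respect to \<open>gauss_seq n (\<lambda>_. 0)\<close>.  The first series is a limit
  of partial sums; for \<open>f, f0 \<in> ell2\<close> it converges for \<open>gauss_seq n f0\<close>-almost every \<open>X\<close>, but in
  general not absolutely.
\<close>

definition loglik :: "nat \<Rightarrow> (nat \<Rightarrow> real) \<Rightarrow> (nat \<Rightarrow> real) \<Rightarrow> real" where
  "loglik n f X = real n * (\<Sum>k. X k * f k) - real n / 2 * (\<Sum>k. (f k)\<^sup>2)"

text \<open>
  For \<open>0 < \<rho> \<le> 1\<close>, a prior concentrated on \<open>ell2\<close> and \<open>f0 \<in> ell2\<close>, the denominator is finite and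
  positive for \<open>gauss_seq n f0\<close>-almost every \<open>X\<close>, so that the conventions for non-integrable
  functions and division by zero matter on a null set only.
\<close>

definition rho_posterior ::
    "(nat \<Rightarrow> real) measure \<Rightarrow> real \<Rightarrow> nat \<Rightarrow> (nat \<Rightarrow> real) \<Rightarrow> (nat \<Rightarrow> real) set \<Rightarrow> real" where
  "rho_posterior Q \<rho> n X B =
     (LINT f:B|Q. exp (\<rho> * loglik n f X)) / (LINT f|Q. exp (\<rho> * loglik n f X))"

definition h_dens :: "real \<Rightarrow> real \<Rightarrow> real" where
  "h_dens p t = exp (- (\<bar>t\<bar> powr p) / p) / (LINT s|lborel. exp (- (\<bar>s\<bar> powr p) / p))"

definition prior :: "real \<Rightarrow> real \<Rightarrow> (nat \<Rightarrow> real) measure" where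
  "prior p \<alpha> =
     distr (PiM UNIV (\<lambda>_. density lborel (\<lambda>t. ennreal (h_dens p t)))) (PiM UNIV (\<lambda>_. borel))
       (\<lambda>\<zeta> k. real (Suc k) powr (- 1/2 - \<alpha>) * \<zeta> k)"

definition rate :: "real \<Rightarrow> real \<Rightarrow> real \<Rightarrow> nat \<Rightarrow> real" where
  "rate p \<alpha> \<beta> n = real n powr (- \<beta> / (2 * \<beta> + p * (\<alpha> - \<beta>) + 1))"

end

theory Submission
  imports Defs "HOL-Real_Asymp.Real_Asymp"
begin

text \<open>
  Take \<open>f\<^sub>0\<close> on the boundary of the hyperrectangle, \<open>f\<^sub>0\<^sub>,\<^sub>k = L k\<^sup>-\<^sup>1\<^sup>/\<^sup>2\<^sup>-\<^sup>\<beta>\<close>.  For \<open>k\<close> at least a large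
  multiple of the cutoff \<open>n\<^bsup>1/(2\<beta>+p(\<alpha>-\<beta>)+1)\<^esup>\<close>, the price \<open>(f\<^sub>0\<^sub>,\<^sub>k / \<sigma>\<^sub>k)\<^sup>p\<close> that the prior charges for
  \<open>f\<^sub>k > f\<^sub>0\<^sub>,\<^sub>k / 2\<close> dominates the information \<open>n f\<^sub>0\<^sub>,\<^sub>k\<^sup>2\<close> in the data, so the posterior probability of
  this event is small.  A function in the small ball satisfies it for at least half of the indices
  of a dyadic block above the cutoff, and Markov's inequality reduces the claim to single
  coordinates.  Since \<open>exp (\<rho> * loglik n f X)\<close> factorises in each coordinate, the estimate for one
  coordinate holds for every \<open>X\<close>, and neither almost sure convergence of \<open>\<Sum>k. X k * f k\<close> nor
  integrability of the weight enters.
\<close>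

section \<open>The density of one prior coordinate\<close>

text \<open>Raising \<open>y / a \<le> exp (y / a)\<close> to the power \<open>a = 2 / p\<close>,
  with \<open>y = |t| powr p / q\<close>, bounds \<open>t^2\<close> by a multiple of
  \<open>exp y\<close>; hence the integrand is at most a multiple of \<open>1 / (1 + t^2)\<close>.
  The scale \<open>q\<close> is separate from \<open>p\<close> because both \<open>q = p\<close> and
  \<open>q = 2 * p\<close> occur.\<close>

lemma exp_minus_powr_integrable:
  fixes p q :: real
  assumes "0 < p" "0 < q"
  shows "integrable lborel (\<lambda>t. exp (- (\<bar>t\<bar> powr p) / q))"
proof (rule Bochner_Integration.integrable_bound)
  define a where "a = 2 / p"
  define C where "C = (q * a) powr a"
  have a: "0 < a" using assms by (simp add: a_def)
  show "integrable lborel (\<lambda>t::real. (1 + C) * inverse (1 + t\<^sup>2))"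
    using integrable_inverse_1_plus_square
    by (simp add: set_integrable_def einterval_eq_UNIV)
  show "AE t in lborel. norm (exp (- (\<bar>t\<bar> powr p) / q)) \<le> norm ((1 + C) * inverse (1 + t\<^sup>2))"
  proof (rule AE_I2)
    fix t :: real
    let ?y = "\<bar>t\<bar> powr p / q"
    have "?y / a \<le> exp (?y / a)"
      using exp_ge_add_one_self[of "?y / a"] by linarith
    hence "(?y / a) powr a \<le> exp (?y / a) powr a"
      using a assms by (intro powr_mono2) auto
    also have "\<dots> = exp ?y"
      using a by (simp add: powr_def)
    finally have "(\<bar>t\<bar> powr p / (q * a)) powr a \<le> exp ?y"
      by (simp add: field_simps)
    moreover have "(\<bar>t\<bar> powr p / (q * a)) powr a = (\<bar>t\<bar> powr p) powr a / C"
      using a assms by (simp add: powr_divide C_def)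
    moreover have "(\<bar>t\<bar> powr p) powr a = t\<^sup>2"
      using assms by (cases "t = 0") (simp_all add: powr_powr a_def powr_numeral)
    moreover have C: "C > 0" using a assms by (simp add: C_def)
    ultimately have "t\<^sup>2 \<le> C * exp ?y" by (simp add: pos_divide_le_eq mult.commute)
    moreover have "1 \<le> exp ?y" using assms by (subst one_le_exp_iff) simp
    ultimately have "1 + t\<^sup>2 \<le> (1 + C) * exp ?y" unfolding distrib_right by linarith
    hence "exp (- ?y) * (1 + t\<^sup>2) \<le> exp (- ?y) * ((1 + C) * exp ?y)" by simp
    also have "\<dots> = 1 + C" by (simp add: exp_minus)
    finally have "exp (- ?y) \<le> (1 + C) * inverse (1 + t\<^sup>2)"
      by (simp add: field_simps add_pos_nonneg)
    thus "norm (exp (- (\<bar>t\<bar> powr p) / q)) \<le> norm ((1 + C) * inverse (1 + t\<^sup>2))"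
      using C by simp
  qed
qed simp

lemma h_dens_normalization_pos:
  fixes p :: real
  assumes "0 < p"
  shows "0 < (LINT s|lborel. exp (- (\<bar>s\<bar> powr p) / p))"
proof -
  have "(LINT s|lborel. exp (- (\<bar>s\<bar> powr p) / p)) \<noteq> 0"
    using exp_minus_powr_integrable[OF assms assms]
    by (subst integral_nonneg_eq_0_iff_AE) (auto simp: ae_filter_eq_bot_iff eventually_False)
  thus ?thesis by (simp add: less_le)
qed

lemma h_dens_measurable [measurable]: "h_dens p \<in> borel_measurable borel"
  unfolding h_dens_def by measurable

lemma prob_space_h_dens:
  assumes "0 < p"
  shows "prob_space (density lborel (\<lambda>t. ennreal (h_dens p t)))"
proof (rule prob_spaceI)
  let ?Z = "LINT s|lborel. exp (- (\<bar>s\<bar> powr p) / p)"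
  have Z: "0 < ?Z" by (rule h_dens_normalization_pos[OF assms])
  have "emeasure (density lborel (\<lambda>t. ennreal (h_dens p t))) UNIV
      = (\<integral>\<^sup>+ t. ennreal (h_dens p t) \<partial>lborel)"
    by (simp add: emeasure_density)
  also have "\<dots> = ennreal (LINT t|lborel. h_dens p t)"
    using exp_minus_powr_integrable[OF assms assms] Z
    by (intro nn_integral_eq_integral) (auto simp: h_dens_def)
  also have "(LINT t|lborel. h_dens p t) = 1"
    using Z by (simp add: h_dens_def)
  finally show "emeasure (density lborel (\<lambda>t. ennreal (h_dens p t)))
      (space (density lborel (\<lambda>t. ennreal (h_dens p t)))) = 1" by simp
qed

text \<open>Half of the exponent is bounded by its value at \<open>T\<close>; the other half stays
  under the integral and keeps it finite. Halving the rate only affects constants in the later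
  balance of exponents.\<close>

lemma h_dens_tail:
  assumes p: "0 < p"
  obtains c where "0 < c"
    "\<And>T. 0 \<le> T \<Longrightarrow>
      measure (density lborel (\<lambda>t. ennreal (h_dens p t))) {T<..} \<le> c * exp (- (T powr p) / (2 * p))"
proof
  let ?Z = "LINT s|lborel. exp (- (\<bar>s\<bar> powr p) / p)"
  let ?I = "LINT s|lborel. exp (- (\<bar>s\<bar> powr p) / (2 * p))"
  have Z: "0 < ?Z" by (rule h_dens_normalization_pos[OF p])
  have int: "integrable lborel (\<lambda>t. exp (- (\<bar>t\<bar> powr p) / (2 * p)))"
    by (rule exp_minus_powr_integrable) (use p in auto)
  have I: "0 \<le> ?I" by simp
  \<comment> \<open>The summand 1 gives strict positivity from \<open>0 \<le> ?I\<close>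
    alone.\<close>
  show "0 < ?I / ?Z + 1" using I Z by (simp add: add_nonneg_pos)
  fix T :: real assume T: "0 \<le> T"
  let ?H = "density lborel (\<lambda>t. ennreal (h_dens p t))"
  interpret prob_space ?H by (rule prob_space_h_dens[OF p])
  have "ennreal (measure ?H {T<..}) = (\<integral>\<^sup>+ t. ennreal (h_dens p t) * indicator {T<..} t \<partial>lborel)"
    by (simp add: emeasure_eq_measure[symmetric] emeasure_density)
  also have "\<dots> \<le> (\<integral>\<^sup>+ t. ennreal (exp (- (T powr p) / (2 * p)) / ?Z * exp (- (\<bar>t\<bar> powr p) / (2 * p))) \<partial>lborel)"
  proof (rule nn_integral_mono)
    fix t :: real
    have "h_dens p t \<le> exp (- (T powr p) / (2 * p)) / ?Z * exp (- (\<bar>t\<bar> powr p) / (2 * p))" if "T < t"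
    proof -
      have "T powr p \<le> t powr p" using that T p by (intro powr_mono2) auto
      hence "- (\<bar>t\<bar> powr p) / p \<le> - (T powr p) / (2 * p) + - (\<bar>t\<bar> powr p) / (2 * p)"
        using p that T by (simp add: field_simps)
      hence "exp (- (\<bar>t\<bar> powr p) / p) \<le> exp (- (T powr p) / (2 * p)) * exp (- (\<bar>t\<bar> powr p) / (2 * p))"
        by (simp add: exp_add[symmetric])
      thus ?thesis using Z by (simp add: h_dens_def divide_right_mono)
    qed
    thus "ennreal (h_dens p t) * indicator {T<..} t
        \<le> ennreal (exp (- (T powr p) / (2 * p)) / ?Z * exp (- (\<bar>t\<bar> powr p) / (2 * p)))"
      by (auto simp: indicator_def intro!: ennreal_leI)
  qed
  also have "\<dots> = ennreal (exp (- (T powr p) / (2 * p)) / ?Z * ?I)"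
    using int Z by (subst nn_integral_eq_integral) auto
  finally have "measure ?H {T<..} \<le> exp (- (T powr p) / (2 * p)) / ?Z * ?I"
    using Z I by (simp add: ennreal_le_iff)
  also have "\<dots> \<le> (?I / ?Z + 1) * exp (- (T powr p) / (2 * p))"
    by (simp add: algebra_simps)
  finally show "measure ?H {T<..} \<le> (?I / ?Z + 1) * exp (- (T powr p) / (2 * p))" .
qed

text \<open>On \<open>{0..1}\<close> the density is at least its value at 1. This mass bounds the
  denominator of a one-coordinate posterior from below.\<close>

lemma h_dens_unit_interval_pos:
  assumes p: "0 < p"
  shows "0 < measure (density lborel (\<lambda>t. ennreal (h_dens p t))) {0..1}"
proof -
  let ?Z = "LINT s|lborel. exp (- (\<bar>s\<bar> powr p) / p)"
  let ?H = "density lborel (\<lambda>t. ennreal (h_dens p t))"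
  have Z: "0 < ?Z" by (rule h_dens_normalization_pos[OF p])
  interpret prob_space ?H by (rule prob_space_h_dens[OF p])
  have "(\<integral>\<^sup>+ t. ennreal (exp (- 1 / p) / ?Z) * indicator {0..1} (t::real) \<partial>lborel)
      \<le> (\<integral>\<^sup>+ t. ennreal (h_dens p t) * indicator {0..1} t \<partial>lborel)"
  proof (rule nn_integral_mono)
    fix t :: real
    have "exp (- 1 / p) / ?Z \<le> h_dens p t" if "0 \<le> t" "t \<le> 1"
    proof -
      have "t powr p \<le> 1 powr p" using that p by (intro powr_mono2) auto
      thus ?thesis using Z p that by (auto simp: h_dens_def divide_right_mono)
    qed
    thus "ennreal (exp (- 1 / p) / ?Z) * indicator {0..1} t \<le> ennreal (h_dens p t) * indicator {0..1} t"
      by (auto simp: indicator_def intro!: ennreal_leI)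
  qed
  also have "\<dots> = ennreal (measure ?H {0..1})"
    by (simp add: emeasure_eq_measure[symmetric] emeasure_density)
  finally have "exp (- 1 / p) / ?Z \<le> measure ?H {0..1}"
    by (simp add: nn_integral_cmult ennreal_le_iff)
  moreover have "0 < exp (- 1 / p) / ?Z" using Z by simp
  ultimately show ?thesis by linarith
qed

section \<open>Likelihood tilting in one dimension\<close>

text \<open>The tilting exponent is at most \<open>n * Y^2 / 2\<close> everywhere and at least
  \<open>- (n * Y^2 / 2 + n * s^2)\<close> on \<open>{0..1}\<close>, so tilting changes the tail
  probability by a bounded factor only. Here \<open>r\<close> stands for \<rho> times the sample
  size, and \<open>a\<close> for the observed coordinate or 0.\<close>

lemma tilted_tail_le:
  fixes H :: "real measure"
  assumes H: "prob_space H" and [measurable_cong]: "sets H = sets borel"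
    and r: "0 \<le> r" "r \<le> n" and a: "\<bar>a\<bar> \<le> \<bar>Y\<bar>" and s: "0 \<le> s"
  shows "ennreal (measure H {0..1}) *
      (\<integral>\<^sup>+ t. ennreal (exp (r * (a * (s * t) - (s * t)\<^sup>2 / 2))) * indicator {t. F < s * t} t \<partial>H)
    \<le> ennreal (exp (n * Y\<^sup>2 + n * s\<^sup>2) * measure H {t. F < s * t}) *
      (\<integral>\<^sup>+ t. ennreal (exp (r * (a * (s * t) - (s * t)\<^sup>2 / 2))) \<partial>H)"
proof -
  interpret prob_space H by (rule H)
  have [simp]: "space H = UNIV" using sets_eq_imp_space_eq[of H borel] assms(2) by simp
  have a2: "a\<^sup>2 \<le> Y\<^sup>2" using a by (simp add: abs_le_square_iff)
  \<comment> \<open>The quadratic \<open>a * u - u^2 / 2\<close> has its maximum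
    \<open>a^2 / 2\<close> at \<open>u = a\<close>.\<close>
  have up: "r * (a * u - u\<^sup>2 / 2) \<le> n * Y\<^sup>2 / 2" for u
  proof -
    have "a * u - u\<^sup>2 / 2 \<le> a\<^sup>2 / 2"
      using zero_le_power2[of "a - u"] by (simp add: power2_eq_square algebra_simps)
    hence "r * (a * u - u\<^sup>2 / 2) \<le> r * (Y\<^sup>2 / 2)" using r a2 by (intro mult_left_mono) auto
    also have "\<dots> \<le> n * (Y\<^sup>2 / 2)" using r by (intro mult_right_mono) auto
    finally show ?thesis by simp
  qed
  have lo: "- (n * Y\<^sup>2 / 2 + n * s\<^sup>2) \<le> r * (a * (s * t) - (s * t)\<^sup>2 / 2)" if "t \<in> {0..1}" for t
  proof -
    have "t\<^sup>2 \<le> 1" using that by (simp add: power_le_one)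
    hence st: "(s * t)\<^sup>2 \<le> s\<^sup>2" using mult_left_mono[of "t\<^sup>2" 1 "s\<^sup>2"] by (simp add: power_mult_distrib)
    have "- (a * (s * t) - (s * t)\<^sup>2 / 2) \<le> a\<^sup>2 / 2 + (s * t)\<^sup>2"
      using zero_le_power2[of "a + s * t"] by (simp add: power2_eq_square algebra_simps)
    also have "\<dots> \<le> Y\<^sup>2 / 2 + s\<^sup>2" using a2 st by simp
    finally have "r * - (a * (s * t) - (s * t)\<^sup>2 / 2) \<le> r * (Y\<^sup>2 / 2 + s\<^sup>2)"
      using r by (intro mult_left_mono) auto
    also have "\<dots> \<le> n * (Y\<^sup>2 / 2 + s\<^sup>2)" using r by (intro mult_right_mono) auto
    finally show ?thesis by (simp add: algebra_simps)
  qed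
  let ?g = "\<lambda>t. ennreal (exp (r * (a * (s * t) - (s * t)\<^sup>2 / 2)))"
  have "(\<integral>\<^sup>+ t. ?g t * indicator {t. F < s * t} t \<partial>H)
      \<le> (\<integral>\<^sup>+ t. ennreal (exp (n * Y\<^sup>2 / 2)) * indicator {t. F < s * t} t \<partial>H)"
    using up by (intro nn_integral_mono mult_right_mono ennreal_leI) auto
  also have "\<dots> = ennreal (exp (n * Y\<^sup>2 / 2) * measure H {t. F < s * t})"
    by (simp add: nn_integral_cmult emeasure_eq_measure ennreal_mult)
  finally have 1: "(\<integral>\<^sup>+ t. ?g t * indicator {t. F < s * t} t \<partial>H)
      \<le> ennreal (exp (n * Y\<^sup>2 / 2) * measure H {t. F < s * t})" .
  have "ennreal (exp (- (n * Y\<^sup>2 / 2 + n * s\<^sup>2)) * measure H {0..1})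
      = (\<integral>\<^sup>+ t. ennreal (exp (- (n * Y\<^sup>2 / 2 + n * s\<^sup>2))) * indicator {0..1} t \<partial>H)"
    by (simp add: nn_integral_cmult emeasure_eq_measure ennreal_mult)
  also have "\<dots> \<le> (\<integral>\<^sup>+ t. ?g t \<partial>H)"
    using lo by (intro nn_integral_mono) (auto simp: indicator_def intro!: ennreal_leI)
  finally have 2: "ennreal (exp (- (n * Y\<^sup>2 / 2 + n * s\<^sup>2)) * measure H {0..1}) \<le> (\<integral>\<^sup>+ t. ?g t \<partial>H)" .
  have "ennreal (measure H {0..1}) * (\<integral>\<^sup>+ t. ?g t * indicator {t. F < s * t} t \<partial>H)
     \<le> ennreal (measure H {0..1}) * ennreal (exp (n * Y\<^sup>2 / 2) * measure H {t. F < s * t})"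
    by (intro mult_left_mono 1) simp
  also have "\<dots> = ennreal (exp (n * Y\<^sup>2 + n * s\<^sup>2) * measure H {t. F < s * t}) *
      ennreal (exp (- (n * Y\<^sup>2 / 2 + n * s\<^sup>2)) * measure H {0..1})"
  proof -
    have "exp (n * Y\<^sup>2 / 2) = exp (n * Y\<^sup>2 + n * s\<^sup>2) * exp (- (n * Y\<^sup>2 / 2 + n * s\<^sup>2))"
      by (simp add: exp_add[symmetric])
    thus ?thesis by (simp add: ennreal_mult[symmetric])
  qed
  also have "\<dots> \<le> ennreal (exp (n * Y\<^sup>2 + n * s\<^sup>2) * measure H {t. F < s * t}) * (\<integral>\<^sup>+ t. ?g t \<partial>H)"
    by (intro mult_left_mono 2) simp
  finally show ?thesis .
qed

section \<open>Changing a single coordinate of a sequence\<close>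

lemma sums_fun_upd:
  fixes u :: "nat \<Rightarrow> real"
  assumes "u sums s"
  shows "u(k := v) sums (s - u k + v)"
proof -
  have "(\<lambda>j. if j = k then v - u k else 0) sums (v - u k)" by (rule sums_single)
  from sums_add[OF assms this]
  have "(\<lambda>j. u j + (if j = k then v - u k else 0)) sums (s + (v - u k))" .
  moreover have "(\<lambda>j. u j + (if j = k then v - u k else 0)) = u(k := v)" by auto
  ultimately show ?thesis by (simp add: algebra_simps)
qed

text \<open>All divergent series share one default value, so changing a term of a divergent series
  leaves its \<open>suminf\<close> unchanged.\<close>

lemma suminf_not_summable: "\<not> summable u \<Longrightarrow> suminf u = (THE s. False)"
  by (auto simp: suminf_def summable_def)

lemma summable_fun_upd_iff:
  fixes u :: "nat \<Rightarrow> real"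
  shows "summable (u(k := v)) \<longleftrightarrow> summable u"
proof
  assume "summable (u(k := v))"
  then obtain s where "u(k := v) sums s" by (auto simp: summable_def)
  from sums_fun_upd[OF this, of k "u k"] show "summable u" by (auto simp: summable_def)
next
  assume "summable u"
  thus "summable (u(k := v))" using sums_fun_upd[OF summable_sums] by (blast intro: sums_summable)
qed

lemma ell2_fun_upd_iff: "g(k := x) \<in> ell2 \<longleftrightarrow> g \<in> ell2"
proof -
  have "(\<lambda>j. ((g(k := x)) j)\<^sup>2) = (\<lambda>j. (g j)\<^sup>2)(k := x\<^sup>2)" by auto
  thus ?thesis by (simp add: ell2_def summable_fun_upd_iff)
qed

text \<open>
  If the series \<open>\<Sum>k. X k * g k\<close> diverges, its junk value does not depend on any single coordinate;
  this is the case \<open>a = 0\<close>.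
\<close>
lemma loglik_fun_upd:
  assumes "g \<in> ell2"
  obtains a where "\<bar>a\<bar> \<le> \<bar>X k\<bar>"
    "\<And>x. loglik n (g(k := x)) X = loglik n (g(k := 0)) X + real n * (a * x - x\<^sup>2 / 2)"
proof -
  have g: "summable (\<lambda>j. ((g(k := 0)) j)\<^sup>2)" using assms ell2_fun_upd_iff[of g k 0] by (simp add: ell2_def)
  have sq: "(\<Sum>j. ((g(k := x)) j)\<^sup>2) = (\<Sum>j. ((g(k := 0)) j)\<^sup>2) + x\<^sup>2" for x
  proof -
    have "(\<lambda>j. ((g(k := x)) j)\<^sup>2) = (\<lambda>j. ((g(k := 0)) j)\<^sup>2)(k := x\<^sup>2)" by auto
    thus ?thesis using sums_fun_upd[OF summable_sums[OF g], of k "x\<^sup>2"] by (simp add: sums_iff)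
  qed
  have upd: "(\<lambda>j. X j * (g(k := x)) j) = (\<lambda>j. X j * (g(k := 0)) j)(k := X k * x)" for x by auto
  show thesis
  proof (cases "summable (\<lambda>j. X j * (g(k := 0)) j)")
    \<comment> \<open>With a convergent series the coordinate enters linearly, with
      \<open>a = X k\<close>.\<close>
    case True
    have *: "(\<Sum>j. X j * (g(k := x)) j) = (\<Sum>j. X j * (g(k := 0)) j) + X k * x" for x
      using sums_fun_upd[OF summable_sums[OF True], of k "X k * x"]
      by (subst upd) (simp add: sums_iff)
    have **: "loglik n (g(k := x)) X = loglik n (g(k := 0)) X + real n * (X k * x - x\<^sup>2 / 2)" for x
      unfolding loglik_def sq[of x] *[of x] by (simp add: algebra_simps)
    show thesis by (rule that[OF _ **]) simp
  next
    case False
    have "\<not> summable (\<lambda>j. X j * (g(k := x)) j)" for x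
      unfolding upd[of x] using False by (simp only: summable_fun_upd_iff not_False_eq_True)
    hence *: "(\<Sum>j. X j * (g(k := x)) j) = (\<Sum>j. X j * (g(k := 0)) j)" for x
      using suminf_not_summable by metis
    have **: "loglik n (g(k := x)) X = loglik n (g(k := 0)) X + real n * (0 * x - x\<^sup>2 / 2)" for x
      unfolding loglik_def sq[of x] *[of x] by (simp add: algebra_simps)
    show thesis by (rule that[OF _ **]) simp
  qed
qed

section \<open>Resampling one coordinate under the prior\<close>

lemma ell2_measurable [measurable]: "ell2 \<in> sets (PiM UNIV (\<lambda>_. borel))"
proof -
  have "ell2 = {f \<in> space (PiM UNIV (\<lambda>_::nat. borel)). (\<Sum>k. ennreal ((f k)\<^sup>2)) \<noteq> top}"
    using summable_suminf_not_top[of "\<lambda>k. (_ k)\<^sup>2"] ennreal_suminf_neq_top[of "\<lambda>k. (_ k)\<^sup>2"]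
    by (simp only: ell2_def space_PiM PiE_UNIV_domain space_borel Pi_UNIV UNIV_I simp_thms) (metis zero_le_power2)
  moreover have "{f \<in> space (PiM UNIV (\<lambda>_::nat. borel)). (\<Sum>k. ennreal ((f k)\<^sup>2)) \<noteq> top}
      \<in> sets (PiM UNIV (\<lambda>_. borel))" by measurable
  ultimately show ?thesis by (simp only:)
qed

lemma loglik_measurable [measurable]:
  "(\<lambda>f. loglik n f X) \<in> borel_measurable (PiM UNIV (\<lambda>_. borel))"
  unfolding loglik_def by measurable

text \<open>The coordinates are independent, so overwriting coordinate \<open>k\<close> by a fresh
  draw from \<open>H\<close> does not change the product law. This isolates one coordinate without
  splitting the index set.\<close>

lemma nn_integral_PiM_resample:
  fixes H :: "'a measure" and k :: 'i
  assumes "prob_space H" and [measurable]: "\<phi> \<in> borel_measurable (PiM UNIV (\<lambda>_. H))"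
  shows "(\<integral>\<^sup>+ x. \<phi> x \<partial>PiM UNIV (\<lambda>_. H)) = (\<integral>\<^sup>+ x. \<integral>\<^sup>+ t. \<phi> (x(k := t)) \<partial>H \<partial>PiM UNIV (\<lambda>_. H))"
proof -
  interpret H: prob_space H by fact
  interpret M: prob_space "PiM UNIV (\<lambda>_::'i. H)" by (rule prob_space_PiM) (rule assms(1))
  interpret pair_sigma_finite H "PiM UNIV (\<lambda>_::'i. H)" ..
  have [measurable]: "(\<lambda>(t, x). x(k := t)) \<in> H \<Otimes>\<^sub>M PiM UNIV (\<lambda>_. H) \<rightarrow>\<^sub>M PiM UNIV (\<lambda>_. H)"
    by (simp add: split_beta' measurable_fun_upd[where J = UNIV])
  have "(\<integral>\<^sup>+ x. \<phi> x \<partial>PiM UNIV (\<lambda>_. H))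
      = (\<integral>\<^sup>+ x. \<phi> x \<partial>distr (H \<Otimes>\<^sub>M PiM UNIV (\<lambda>_. H)) (PiM UNIV (\<lambda>_. H)) (\<lambda>(t, x). x(k := t)))"
    \<comment> \<open>The library fact adds a coordinate \<open>k\<close> to an index set; as
      \<open>insert k UNIV = UNIV\<close>, it overwrites the existing one.\<close>
    using distr_pair_PiM_eq_PiM[of UNIV "\<lambda>_. H" k] assms(1) by simp
  also have "\<dots> = (\<integral>\<^sup>+ z. \<phi> (case z of (t, x) \<Rightarrow> x(k := t)) \<partial>(H \<Otimes>\<^sub>M PiM UNIV (\<lambda>_. H)))"
    by (rule nn_integral_distr) measurable
  also have "\<dots> = (\<integral>\<^sup>+ x. \<integral>\<^sup>+ t. \<phi> (x(k := t)) \<partial>H \<partial>PiM UNIV (\<lambda>_. H))"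
    by (subst nn_integral_snd[symmetric]) (auto simp: split_beta')
  finally show ?thesis .
qed

text \<open>With the other coordinates fixed, the weight is a constant times a one-dimensional tilt,
  to which \<open>tilted_tail_le\<close> applies. The resulting factor does not depend on the other
  coordinates, so it survives integration over them. The product form stays meaningful when the
  integrals are infinite.\<close>

lemma weighted_coordinate_tail:
  fixes H :: "real measure" and \<sigma> :: "nat \<Rightarrow> real"
  defines "Q \<equiv> distr (PiM UNIV (\<lambda>_. H)) (PiM UNIV (\<lambda>_. borel)) (\<lambda>\<zeta> k. \<sigma> k * \<zeta> k)"
  assumes H: "prob_space H" and sets_H [measurable_cong]: "sets H = sets borel"
    and \<rho>: "0 \<le> \<rho>" "\<rho> \<le> 1" and \<sigma>: "0 \<le> \<sigma> k"
  shows "ennreal (measure H {0..1}) *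
      (\<integral>\<^sup>+ f. ennreal (exp (\<rho> * loglik n f X)) * indicator (ell2 \<inter> {f. F < f k}) f \<partial>Q)
    \<le> ennreal (exp (n * (X k)\<^sup>2 + n * (\<sigma> k)\<^sup>2) * measure H {t. F < \<sigma> k * t}) *
      (\<integral>\<^sup>+ f. ennreal (exp (\<rho> * loglik n f X)) * indicator ell2 f \<partial>Q)"
proof -
  let ?M = "PiM UNIV (\<lambda>_::nat. H)"
  let ?S = "\<lambda>\<zeta> k. \<sigma> k * \<zeta> k"
  define W where "W f = ennreal (exp (\<rho> * loglik n f X)) * indicator ell2 f" for f
  let ?V = "\<lambda>f. W f * indicator {f. F < f k} f"
  define m where "m = measure H {0..1}"
  define R where "R = exp (n * (X k)\<^sup>2 + n * (\<sigma> k)\<^sup>2) * measure H {t. F < \<sigma> k * t}"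
  have [simp]: "space H = UNIV" using sets_eq_imp_space_eq[OF sets_H] by simp
  have W_meas [measurable]: "W \<in> borel_measurable (PiM UNIV (\<lambda>_. borel))" unfolding W_def by measurable
  have [measurable]: "{f. F < f k} \<in> sets (PiM UNIV (\<lambda>_::nat. borel))"
  proof -
    have "{f \<in> space (PiM UNIV (\<lambda>_::nat. borel)). F < f k} \<in> sets (PiM UNIV (\<lambda>_. borel))" by measurable
    thus ?thesis by (simp add: space_PiM)
  qed
  have [measurable]: "?S \<in> ?M \<rightarrow>\<^sub>M PiM UNIV (\<lambda>_. borel)"
    by (rule measurable_PiM_single') (auto intro!: borel_measurable_times measurable_compose[OF measurable_component_singleton])
  have Q: "(\<integral>\<^sup>+ f. \<phi> f \<partial>Q) = (\<integral>\<^sup>+ x. \<integral>\<^sup>+ t. \<phi> ((?S x)(k := \<sigma> k * t)) \<partial>H \<partial>?M)"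
    if [measurable]: "\<phi> \<in> borel_measurable (PiM UNIV (\<lambda>_. borel))" for \<phi>
  proof -
    have "(\<integral>\<^sup>+ f. \<phi> f \<partial>Q) = (\<integral>\<^sup>+ x. \<phi> (?S x) \<partial>?M)"
      unfolding Q_def by (rule nn_integral_distr) measurable
    also have "\<dots> = (\<integral>\<^sup>+ x. \<integral>\<^sup>+ t. \<phi> (?S (x(k := t))) \<partial>H \<partial>?M)"
      by (rule nn_integral_PiM_resample[OF H]) measurable
    also have "(\<lambda>x t. ?S (x(k := t))) = (\<lambda>x t. (?S x)(k := \<sigma> k * t))" by (intro ext) auto
    finally show ?thesis .
  qed
  have upd: "(\<lambda>(x, t). (?S x)(k := \<sigma> k * t)) \<in> ?M \<Otimes>\<^sub>M H \<rightarrow>\<^sub>M PiM UNIV (\<lambda>_. borel)"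
    by (rule measurable_PiM_single') (auto simp: fun_upd_def split_beta')
  have inner: "ennreal m * (\<integral>\<^sup>+ t. ?V ((?S x)(k := \<sigma> k * t)) \<partial>H)
      \<le> ennreal R * (\<integral>\<^sup>+ t. W ((?S x)(k := \<sigma> k * t)) \<partial>H)" for x
  proof (cases "?S x \<in> ell2")
    \<comment> \<open>Changing one coordinate cannot restore square summability, so both sides
      vanish.\<close>
    case False
    thus ?thesis by (simp add: W_def ell2_fun_upd_iff)
  next
    case True
    obtain a where a: "\<bar>a\<bar> \<le> \<bar>X k\<bar>"
      and eq: "\<And>y. loglik n ((?S x)(k := y)) X = loglik n ((?S x)(k := 0)) X + real n * (a * y - y\<^sup>2 / 2)"
      using loglik_fun_upd[OF True, of X k n] by blast
    \<comment> \<open>This factor of the weight does not involve the resampled coordinate and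
      cancels in the comparison.\<close>
    define c where "c = ennreal (exp (\<rho> * loglik n ((?S x)(k := 0)) X))"
    let ?g = "\<lambda>t. ennreal (exp ((\<rho> * n) * (a * (\<sigma> k * t) - (\<sigma> k * t)\<^sup>2 / 2)))"
    have W: "W ((?S x)(k := \<sigma> k * t)) = c * ?g t" for t
      using True unfolding W_def
      by (subst eq) (simp add: ell2_fun_upd_iff c_def ennreal_mult[symmetric] exp_add[symmetric] algebra_simps)
    have ind: "indicator {f. F < f k} ((?S x)(k := \<sigma> k * t)) = (indicator {t. F < \<sigma> k * t} t :: ennreal)" for t
      by (simp add: indicator_def)
    have "(\<integral>\<^sup>+ t. ?V ((?S x)(k := \<sigma> k * t)) \<partial>H)
        = (\<integral>\<^sup>+ t. c * (?g t * indicator {t. F < \<sigma> k * t} t) \<partial>H)"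
      by (simp only: W ind mult.assoc)
    also have "\<dots> = c * (\<integral>\<^sup>+ t. ?g t * indicator {t. F < \<sigma> k * t} t \<partial>H)"
      by (rule nn_integral_cmult) measurable
    finally have "ennreal m * (\<integral>\<^sup>+ t. ?V ((?S x)(k := \<sigma> k * t)) \<partial>H)
        = c * (ennreal m * (\<integral>\<^sup>+ t. ?g t * indicator {t. F < \<sigma> k * t} t \<partial>H))"
      by (simp only: mult_ac)
    also have "\<dots> \<le> c * (ennreal R * (\<integral>\<^sup>+ t. ?g t \<partial>H))"
      unfolding m_def R_def using \<rho> \<sigma> a
      by (intro mult_left_mono tilted_tail_le[OF H sets_H]) (auto intro: mult_left_le_one_le)
    also have "\<dots> = ennreal R * (c * (\<integral>\<^sup>+ t. ?g t \<partial>H))"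
      by (simp only: mult_ac)
    also have "c * (\<integral>\<^sup>+ t. ?g t \<partial>H) = (\<integral>\<^sup>+ t. W ((?S x)(k := \<sigma> k * t)) \<partial>H)"
      unfolding W by (rule nn_integral_cmult[symmetric]) measurable
    finally show ?thesis .
  qed
  interpret H: prob_space H by (rule H)
  have meas: "(\<lambda>x. \<integral>\<^sup>+ t. \<phi> ((?S x)(k := \<sigma> k * t)) \<partial>H) \<in> borel_measurable ?M"
    if "\<phi> \<in> borel_measurable (PiM UNIV (\<lambda>_. borel))" for \<phi> :: "(nat \<Rightarrow> real) \<Rightarrow> ennreal"
    using measurable_compose[OF upd that]
    by (intro H.borel_measurable_nn_integral) (simp add: split_beta')
  have V: "?V \<in> borel_measurable (PiM UNIV (\<lambda>_. borel))" by measurable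
  have "ennreal m * (\<integral>\<^sup>+ f. ?V f \<partial>Q) = (\<integral>\<^sup>+ x. ennreal m * (\<integral>\<^sup>+ t. ?V ((?S x)(k := \<sigma> k * t)) \<partial>H) \<partial>?M)"
    unfolding Q[OF V] by (rule nn_integral_cmult[OF meas[OF V], symmetric])
  also have "\<dots> \<le> (\<integral>\<^sup>+ x. ennreal R * (\<integral>\<^sup>+ t. W ((?S x)(k := \<sigma> k * t)) \<partial>H) \<partial>?M)"
    by (intro nn_integral_mono inner)
  also have "\<dots> = ennreal R * (\<integral>\<^sup>+ f. W f \<partial>Q)"
    unfolding Q[OF W_meas] by (rule nn_integral_cmult[OF meas[OF W_meas]])
  finally show ?thesis
    by (simp only: W_def m_def R_def indicator_inter_arith mult.assoc)
qed

section \<open>From single coordinates to the posterior of a set\<close>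

text \<open>This is Markov's inequality: on \<open>B\<close> at least \<open>N\<close> of the events
  \<open>F k < f k\<close> occur, so the indicator of \<open>B\<close> is at most their count
  divided by \<open>N\<close>, and \<open>coord\<close> bounds the posterior mean of the
  count.\<close>

lemma rho_posterior_le:
  fixes F R :: "nat \<Rightarrow> real"
  assumes [measurable_cong]: "sets Q = sets (PiM UNIV (\<lambda>_::nat. borel))"
    and J: "finite J" and N: "0 < N" and R: "\<And>k. k \<in> J \<Longrightarrow> 0 \<le> R k"
    and B: "\<And>f. f \<in> B \<Longrightarrow> f \<in> ell2 \<and> N \<le> (\<Sum>k\<in>J. indicator {f. F k < f k} f)"
    and coord: "\<And>k. k \<in> J \<Longrightarrow>
      (\<integral>\<^sup>+ f. ennreal (exp (\<rho> * loglik n f X)) * indicator (ell2 \<inter> {f. F k < f k}) f \<partial>Q)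
      \<le> ennreal (R k) * (\<integral>\<^sup>+ f. ennreal (exp (\<rho> * loglik n f X)) * indicator ell2 f \<partial>Q)"
  shows "rho_posterior Q \<rho> n X B \<le> (\<Sum>k\<in>J. R k) / N"
proof -
  let ?w = "\<lambda>f. exp (\<rho> * loglik n f X)"
  have nonneg: "0 \<le> (\<Sum>k\<in>J. R k) / N" using R N by (simp add: sum_nonneg)
  have [measurable]: "{f. F k < f k} \<in> sets (PiM UNIV (\<lambda>_::nat. borel))" for k
  proof -
    have "{f \<in> space (PiM UNIV (\<lambda>_::nat. borel)). F k < f k} \<in> sets (PiM UNIV (\<lambda>_. borel))" by measurable
    thus ?thesis by (simp add: space_PiM)
  qed
  show ?thesis
  proof (cases "integrable Q ?w \<and> set_integrable Q B ?w")
    case False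
    \<comment> \<open>A non-integrable numerator or denominator has integral 0, which makes the quotient 0.\<close>
    hence "rho_posterior Q \<rho> n X B = 0"
      by (auto simp: rho_posterior_def set_lebesgue_integral_def set_integrable_def not_integrable_integral_eq)
    thus ?thesis using nonneg by simp
  next
    case True
    define D where "D = (LINT f|Q. ?w f)"
    define E where "E = (LINT f:B|Q. ?w f)"
    have D0: "0 \<le> D" unfolding D_def by simp
    have D: "ennreal D = (\<integral>\<^sup>+ f. ennreal (?w f) \<partial>Q)"
      unfolding D_def using True by (intro nn_integral_eq_integral[symmetric]) auto
    have "ennreal E = (\<integral>\<^sup>+ f. ennreal (indicator B f * ?w f) \<partial>Q)"
      unfolding E_def set_lebesgue_integral_def using True
      by (subst nn_integral_eq_integral[symmetric]) (auto simp: set_integrable_def)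
    also have "\<dots> \<le> (\<integral>\<^sup>+ f. ennreal (1 / N) * (\<Sum>k\<in>J. ennreal (?w f) * indicator (ell2 \<inter> {f. F k < f k}) f) \<partial>Q)"
    proof (rule nn_integral_mono)
      fix f
      show "ennreal (indicator B f * ?w f)
        \<le> ennreal (1 / N) * (\<Sum>k\<in>J. ennreal (?w f) * indicator (ell2 \<inter> {f. F k < f k}) f)"
      proof (cases "f \<in> B")
        case True
        have "ennreal (?w f) * indicator (ell2 \<inter> {f. F k < f k}) f = ennreal (?w f * indicator {f. F k < f k} f)" for k
          using B[OF True] by (simp add: indicator_def)
        hence "ennreal (1 / N) * (\<Sum>k\<in>J. ennreal (?w f) * indicator (ell2 \<inter> {f. F k < f k}) f)
            = ennreal (1 / N * (?w f * (\<Sum>k\<in>J. indicator {f. F k < f k} f)))"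
          using N by (simp only: sum_ennreal sum_distrib_left[symmetric] ennreal_mult[symmetric]
              sum_nonneg indicator_pos_le exp_ge_zero mult_nonneg_nonneg divide_nonneg_nonneg
              zero_le_one less_imp_le)
        moreover have "?w f \<le> 1 / N * (?w f * (\<Sum>k\<in>J. indicator {f. F k < f k} f))"
          using B[OF True] N by (simp add: field_simps)
        ultimately show ?thesis using True by (simp add: ennreal_leI)
      qed simp
    qed
    also have "\<dots> = ennreal (1 / N) * (\<Sum>k\<in>J. \<integral>\<^sup>+ f. ennreal (?w f) * indicator (ell2 \<inter> {f. F k < f k}) f \<partial>Q)"
      by (subst nn_integral_cmult, measurable, subst nn_integral_sum) auto
    also have "\<dots> \<le> ennreal (1 / N) * (\<Sum>k\<in>J. ennreal (R k) * ennreal D)"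
    proof (intro mult_left_mono sum_mono)
      fix k assume "k \<in> J"
      note coord[OF this]
      also have "(\<integral>\<^sup>+ f. ennreal (?w f) * indicator ell2 f \<partial>Q) \<le> ennreal D"
        unfolding D by (intro nn_integral_mono) (auto simp: indicator_def)
      hence "ennreal (R k) * (\<integral>\<^sup>+ f. ennreal (?w f) * indicator ell2 f \<partial>Q) \<le> ennreal (R k) * ennreal D"
        by (intro mult_left_mono) auto
      finally show "(\<integral>\<^sup>+ f. ennreal (?w f) * indicator (ell2 \<inter> {f. F k < f k}) f \<partial>Q)
          \<le> ennreal (R k) * ennreal D" .
    qed simp
    also have "\<dots> = ennreal (1 / N) * (ennreal (\<Sum>k\<in>J. R k) * ennreal D)"
      using R by (simp add: sum_ennreal sum_distrib_right[symmetric])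
    also have "\<dots> = ennreal ((\<Sum>k\<in>J. R k) / N * D)"
      using R N D0 by (simp add: ennreal_mult[symmetric] sum_nonneg)
    finally have "E \<le> (\<Sum>k\<in>J. R k) / N * D"
      by (subst (asm) ennreal_le_iff) (intro mult_nonneg_nonneg nonneg D0)
    \<comment> \<open>For \<open>D = 0\<close> the quotient is 0 by convention, and the bound is
      nonnegative.\<close>
    hence "E / D \<le> (\<Sum>k\<in>J. R k) / N"
      using D0 nonneg by (cases "D = 0") (simp_all add: divide_le_eq)
    thus ?thesis by (simp add: rho_posterior_def D_def E_def)
  qed
qed

section \<open>One coordinate under the law of the data\<close>

text \<open>The deviation \<open>X k - f k\<close> is a standard normal variable divided by
  \<open>sqrt n\<close>. Its second moment is all that is required of the noise.\<close>

lemma gauss_seq_coordinate: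
  assumes "0 < n"
  shows "integrable (gauss_seq n f) (\<lambda>X. (X k - f k)\<^sup>2)"
    and "(LINT X|gauss_seq n f. (X k - f k)\<^sup>2) = 1 / real n"
    and "prob_space (gauss_seq n f)"
proof -
  let ?N = "density lborel (\<lambda>x. ennreal (std_normal_density x))"
  let ?G = "PiM UNIV (\<lambda>_::nat. ?N)"
  have N: "prob_space ?N" using prob_space_normal_density[of 1 0] by simp
  have [measurable]: "(\<lambda>\<xi> k. f k + \<xi> k / sqrt (real n)) \<in> ?G \<rightarrow>\<^sub>M PiM UNIV (\<lambda>_. borel)"
    by (rule measurable_PiM_single') (auto simp: space_PiM)
  have comp: "distr ?G ?N (\<lambda>\<xi>. \<xi> k) = ?N"
    by (rule distr_PiM_component) (use N in auto)
  have int: "integrable ?N (\<lambda>x. x\<^sup>2 / real n)"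
    using integrable_std_normal_moment[of 2]
    by (subst integrable_density) auto
  have val: "(LINT x|?N. x\<^sup>2 / real n) = 1 / real n"
    using integral_std_normal_moment_even[of 1]
    by (subst integral_density) (auto simp: fact_numeral)
  have "integrable ?G (\<lambda>\<xi>. (\<xi> k)\<^sup>2 / real n)"
    by (rule integrable_distr[where M = ?G and M' = ?N and T = "\<lambda>\<xi>. \<xi> k" and f = "\<lambda>x. x\<^sup>2 / real n"])
      (use int in \<open>simp_all add: comp\<close>)
  thus "integrable (gauss_seq n f) (\<lambda>X. (X k - f k)\<^sup>2)"
    unfolding gauss_seq_def by (subst integrable_distr_eq) (simp_all add: power_divide)
  have "(LINT X|gauss_seq n f. (X k - f k)\<^sup>2) = (LINT \<xi>|?G. (\<xi> k)\<^sup>2 / real n)"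
    unfolding gauss_seq_def by (subst integral_distr) (simp_all add: power_divide)
  also have "\<dots> = (LINT x|distr ?G ?N (\<lambda>\<xi>. \<xi> k). x\<^sup>2 / real n)"
    by (subst integral_distr) simp_all
  finally show "(LINT X|gauss_seq n f. (X k - f k)\<^sup>2) = 1 / real n"
    by (simp only: comp val)
  show "prob_space (gauss_seq n f)"
    unfolding gauss_seq_def
    by (rule prob_space.prob_space_distr) (auto intro!: prob_space_PiM N)
qed

text \<open>
  The second term of the bound is the tilted tail probability on the event
  \<open>n (X k - x)\<^sup>2 \<le> A / 4\<close>; on the complement the first term exceeds 1.
\<close>
lemma coordinate_tail_le:
  fixes H :: "real measure" and \<sigma> :: "nat \<Rightarrow> real"
  defines "Q \<equiv> distr (PiM UNIV (\<lambda>_. H)) (PiM UNIV (\<lambda>_. borel)) (\<lambda>\<zeta> k. \<sigma> k * \<zeta> k)"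
  assumes H: "prob_space H" and sets_H: "sets H = sets borel"
    and \<rho>: "0 \<le> \<rho>" "\<rho> \<le> 1" and \<sigma>: "0 \<le> \<sigma> k"
    and h: "0 < measure H {0..1}" and c: "0 \<le> c"
    and tail: "measure H {t. F < \<sigma> k * t} \<le> c * exp (- V)"
    and A: "0 < A" and V: "2 * (n * x\<^sup>2) + n * (\<sigma> k)\<^sup>2 + A \<le> V"
  shows "(\<integral>\<^sup>+ f. ennreal (exp (\<rho> * loglik n f X)) * indicator (ell2 \<inter> {f. F < f k}) f \<partial>Q)
    \<le> ennreal (4 * (n * (X k - x)\<^sup>2) / A + c / measure H {0..1} * exp (- A / 2)) *
      (\<integral>\<^sup>+ f. ennreal (exp (\<rho> * loglik n f X)) * indicator ell2 f \<partial>Q)"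
    (is "?I1 \<le> ennreal (?R1 + ?R2) * ?I2")
proof -
  define m where "m = measure H {0..1}"
  have m: "0 < m" using h by (simp add: m_def)
  have R1: "0 \<le> ?R1" using A by simp
  have R2: "0 \<le> ?R2" using c by simp
  show ?thesis
  proof (cases "A / 4 < n * (X k - x)\<^sup>2")
    case True
    have "?I1 \<le> ?I2" by (intro nn_integral_mono) (simp add: indicator_def)
    also have "\<dots> = ennreal 1 * ?I2" by simp
    also have "\<dots> \<le> ennreal (?R1 + ?R2) * ?I2"
    proof (intro mult_right_mono ennreal_leI)
      have "1 \<le> ?R1" using True A by (simp add: field_simps)
      thus "1 \<le> ?R1 + ?R2" using R2 by linarith
    qed simp
    finally show ?thesis .
  next
    case False
    \<comment> \<open>The deviation contributes at most \<open>A / 2\<close> to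
      \<open>n * (X k)^2\<close>, which uses up half of the margin \<open>A\<close> in the
      hypothesis on \<open>V\<close> and leaves the exponent \<open>- A / 2\<close>.\<close>
    have "(X k)\<^sup>2 \<le> 2 * x\<^sup>2 + 2 * (X k - x)\<^sup>2"
      using zero_le_power2[of "X k - 2 * x"] by (simp add: power2_eq_square algebra_simps)
    hence "n * (X k)\<^sup>2 \<le> n * (2 * x\<^sup>2 + 2 * (X k - x)\<^sup>2)" by (intro mult_left_mono) auto
    hence "n * (X k)\<^sup>2 + n * (\<sigma> k)\<^sup>2 + - V \<le> - A / 2"
      using V False by (simp add: algebra_simps)
    hence "exp (n * (X k)\<^sup>2 + n * (\<sigma> k)\<^sup>2) * exp (- V) \<le> exp (- A / 2)"
      by (simp only: exp_add[symmetric] exp_le_cancel_iff)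
    hence "c * (exp (n * (X k)\<^sup>2 + n * (\<sigma> k)\<^sup>2) * exp (- V)) \<le> c * exp (- A / 2)"
      using c by (rule mult_left_mono)
    moreover have "exp (n * (X k)\<^sup>2 + n * (\<sigma> k)\<^sup>2) * measure H {t. F < \<sigma> k * t}
        \<le> exp (n * (X k)\<^sup>2 + n * (\<sigma> k)\<^sup>2) * (c * exp (- V))"
      by (intro mult_left_mono tail) simp
    ultimately have r: "exp (n * (X k)\<^sup>2 + n * (\<sigma> k)\<^sup>2) * measure H {t. F < \<sigma> k * t} \<le> c * exp (- A / 2)"
      by (simp only: mult.left_commute order.trans)
    \<comment> \<open>Multiplying and dividing by the mass \<open>m\<close> of the unit interval
      gives the form of \<open>weighted_coordinate_tail\<close>.\<close>
    have "?I1 = ennreal (1 / m) * (ennreal m * ?I1)"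
      using m by (simp add: mult.assoc[symmetric] ennreal_mult[symmetric])
    also have "\<dots> \<le> ennreal (1 / m) *
        (ennreal (exp (n * (X k)\<^sup>2 + n * (\<sigma> k)\<^sup>2) * measure H {t. F < \<sigma> k * t}) * ?I2)"
      unfolding m_def Q_def
      by (intro mult_left_mono weighted_coordinate_tail H sets_H \<rho> \<sigma>) simp
    also have "\<dots> \<le> ennreal (1 / m) * (ennreal (c * exp (- A / 2)) * ?I2)"
      by (intro mult_left_mono mult_right_mono ennreal_leI r) simp_all
    also have "\<dots> = ennreal (c / m * exp (- A / 2)) * ?I2"
      using m c by (simp add: mult.assoc[symmetric] ennreal_mult[symmetric])
    also have "\<dots> \<le> ennreal (?R1 + ?R2) * ?I2"
      unfolding m_def using R1 by (intro mult_right_mono ennreal_leI) simp_all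
    finally show ?thesis .
  qed
qed

section \<open>The small ball and the balance of exponents\<close>

lemma ell2_diff:
  assumes "f \<in> ell2" "g \<in> ell2"
  shows "(\<lambda>k. f k - g k) \<in> ell2"
proof -
  have "summable (\<lambda>k. 2 * (f k)\<^sup>2 + 2 * (g k)\<^sup>2)"
    using assms by (intro summable_add summable_mult) (auto simp: ell2_def)
  moreover have "(f k - g k)\<^sup>2 \<le> 2 * (f k)\<^sup>2 + 2 * (g k)\<^sup>2" for k
    using zero_le_power2[of "f k + g k"] by (simp add: power2_eq_square algebra_simps)
  ultimately show ?thesis
    unfolding ell2_def by (auto intro: summable_comparison_test')
qed

text \<open>Each \<open>k\<close> in \<open>J\<close> with \<open>f k \<le> f0 k / 2\<close> adds at
  least \<open>d^2 / 4\<close> to the squared distance. The bound on \<open>r^2\<close> leaves room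
  for at most half of \<open>J\<close> to do so.\<close>

lemma half_of_large_coordinates:
  assumes f: "f \<in> ell2" "f0 \<in> ell2" and J: "finite J"
    and d: "0 < d" "\<And>k. k \<in> J \<Longrightarrow> d \<le> f0 k"
    and r: "ell2_norm (\<lambda>k. f k - f0 k) < r" "r\<^sup>2 \<le> real (card J) * d\<^sup>2 / 8"
  shows "real (card J) / 2 \<le> (\<Sum>k\<in>J. indicator {f. f0 k / 2 < f k} f)"
proof -
  have s: "summable (\<lambda>k. (f k - f0 k)\<^sup>2)" using ell2_diff[OF f] by (simp add: ell2_def)
  have "d\<^sup>2 / 4 * (1 - indicator {f. f0 k / 2 < f k} f) \<le> (f k - f0 k)\<^sup>2" if "k \<in> J" for k
  proof (cases "f0 k / 2 < f k")
    case False
    hence "d / 2 \<le> f0 k - f k" using d(2)[OF that] by linarith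
    hence "(d / 2)\<^sup>2 \<le> (f0 k - f k)\<^sup>2" using d(1) by (intro power_mono) auto
    thus ?thesis using False by (simp add: power_divide power2_commute)
  qed simp
  hence "(\<Sum>k\<in>J. d\<^sup>2 / 4 * (1 - indicator {f. f0 k / 2 < f k} f)) \<le> (\<Sum>k\<in>J. (f k - f0 k)\<^sup>2)"
    by (rule sum_mono)
  also have "\<dots> \<le> (\<Sum>k. (f k - f0 k)\<^sup>2)" by (rule sum_le_suminf[OF s J]) simp
  also have "\<dots> = (ell2_norm (\<lambda>k. f k - f0 k))\<^sup>2"
    unfolding ell2_norm_def using suminf_nonneg[OF s] by simp
  also have "\<dots> \<le> r\<^sup>2"
    using r(1) suminf_nonneg[OF s] by (intro power_mono) (auto simp: ell2_norm_def)
  also note r(2)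
  finally have "d\<^sup>2 / 4 * (\<Sum>k\<in>J. 1 - indicator {f. f0 k / 2 < f k} f) \<le> d\<^sup>2 / 4 * (real (card J) / 2)"
    by (simp only: sum_distrib_left) (simp add: mult_ac)
  hence "(\<Sum>k\<in>J. 1 - indicator {f. f0 k / 2 < f k} f) \<le> real (card J) / 2"
    using d(1) by (subst (asm) mult_le_cancel_left_pos) auto
  thus ?thesis by (simp add: sum_subtractf)
qed

text \<open>Every weighted coordinate equals \<open>L\<close> exactly, and the squares are summable
  because \<beta> is positive.\<close>

lemma powr_sequence_in_hyperrectangle:
  assumes "0 < L" "0 < \<beta>"
  shows "(\<lambda>k. L * real (Suc k) powr (- 1 / 2 - \<beta>)) \<in> hyperrectangle \<beta> L"
proof -
  have "summable (\<lambda>k. real (Suc k) powr (- 1 - 2 * \<beta>))"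
    using assms by (subst summable_Suc_iff) (simp add: summable_real_powr_iff)
  hence "summable (\<lambda>k. L\<^sup>2 * real (Suc k) powr (- 1 - 2 * \<beta>))" by (rule summable_mult)
  moreover have "(L * real (Suc k) powr (- 1 / 2 - \<beta>))\<^sup>2 = L\<^sup>2 * real (Suc k) powr (- 1 - 2 * \<beta>)" for k
    by (simp add: power_mult_distrib power2_eq_square powr_add[symmetric] del: of_nat_Suc)
  moreover have "\<bar>L * real (Suc k) powr (- 1 / 2 - \<beta>)\<bar> * real (Suc k) powr (\<beta> + 1 / 2) = L" for k
    using assms by (simp add: abs_mult mult.assoc powr_add[symmetric] del: of_nat_Suc)
  ultimately show ?thesis by (simp add: hyperrectangle_def ell2_def)
qed

text \<open>Here \<kappa> is the coordinate number. The information
  \<open>n * \<kappa> powr (- 1 - 2 * \<beta>)\<close> divided by the price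
  \<open>\<kappa> powr (p * (\<alpha> - \<beta>))\<close> is \<open>n * \<kappa> powr (- a)\<close>,
  at most \<open>C powr (- a)\<close> beyond the cutoff. The right-hand side is
  \<open>2 * c0\<close> times the price: one \<open>c0\<close> pays for the information, the other
  leaves the margin.\<close>

lemma exponent_balance:
  fixes C L n \<kappa> \<alpha> \<beta> p :: real
  defines "a \<equiv> 2 * \<beta> + p * (\<alpha> - \<beta>) + 1"
  assumes pos: "0 < p" "0 < L" "0 < \<beta>" "\<beta> < \<alpha>" "0 < C" "0 < n" "1 \<le> \<kappa>"
    and \<kappa>: "C * n powr (1 / a) \<le> \<kappa>"
    and C: "(2 * L\<^sup>2 + 1) * C powr (- a) \<le> c0" and c0: "4 * p * c0 = (L / 2) powr p"
  shows "2 * (n * (L * \<kappa> powr (- 1 / 2 - \<beta>))\<^sup>2) + n * (\<kappa> powr (- 1 / 2 - \<alpha>))\<^sup>2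
      + c0 * (C * n powr (1 / a)) powr (p * (\<alpha> - \<beta>))
    \<le> (L / 2 * \<kappa> powr (\<alpha> - \<beta>)) powr p / (2 * p)"
proof -
  define \<gamma> where "\<gamma> = p * (\<alpha> - \<beta>)"
  have \<gamma>: "0 < \<gamma>" using pos by (simp add: \<gamma>_def)
  have a: "0 < a" using pos by (simp add: a_def add_pos_pos)
  have c0_pos: "0 < c0"
  proof -
    have "0 < 4 * p * c0" unfolding c0 using pos by simp
    thus ?thesis using pos by (simp add: zero_less_mult_iff)
  qed
  have "C powr a * n = (C * n powr (1 / a)) powr a"
    using pos a by (simp add: powr_mult powr_powr)
  also have "\<dots> \<le> \<kappa> powr a" using \<kappa> pos a by (intro powr_mono2) auto
  finally have "n \<le> C powr (- a) * \<kappa> powr a"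
    using pos by (simp add: powr_minus field_simps)
  hence "n * \<kappa> powr (- 1 - 2 * \<beta>) \<le> C powr (- a) * \<kappa> powr a * \<kappa> powr (- 1 - 2 * \<beta>)"
    by (intro mult_right_mono) auto
  also have "\<dots> = C powr (- a) * \<kappa> powr \<gamma>"
    by (simp add: mult.assoc powr_add[symmetric] a_def \<gamma>_def)
  finally have n: "n * \<kappa> powr (- 1 - 2 * \<beta>) \<le> C powr (- a) * \<kappa> powr \<gamma>" .
  have F: "(L * \<kappa> powr (- 1 / 2 - \<beta>))\<^sup>2 = L\<^sup>2 * \<kappa> powr (- 1 - 2 * \<beta>)"
    by (simp add: power_mult_distrib power2_eq_square powr_add[symmetric])
  have "(\<kappa> powr (- 1 / 2 - \<alpha>))\<^sup>2 = \<kappa> powr (- 1 - 2 * \<alpha>)"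
    by (simp add: power2_eq_square powr_add[symmetric])
  \<comment> \<open>Since the prior decays faster than the signal, the term with its scale is
    absorbed into the information.\<close>
  also have "\<dots> \<le> \<kappa> powr (- 1 - 2 * \<beta>)" using pos by (intro powr_mono) auto
  finally have "n * (\<kappa> powr (- 1 / 2 - \<alpha>))\<^sup>2 \<le> n * \<kappa> powr (- 1 - 2 * \<beta>)"
    using pos by (intro mult_left_mono) auto
  hence "2 * (n * (L * \<kappa> powr (- 1 / 2 - \<beta>))\<^sup>2) + n * (\<kappa> powr (- 1 / 2 - \<alpha>))\<^sup>2
      \<le> (2 * L\<^sup>2 + 1) * (n * \<kappa> powr (- 1 - 2 * \<beta>))"
    unfolding F by (simp add: algebra_simps)
  also have "\<dots> \<le> (2 * L\<^sup>2 + 1) * (C powr (- a) * \<kappa> powr \<gamma>)"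
    by (intro mult_left_mono n) simp
  also have "\<dots> \<le> c0 * \<kappa> powr \<gamma>"
    using mult_right_mono[OF C, of "\<kappa> powr \<gamma>"] by (simp add: mult.assoc)
  finally have 1: "2 * (n * (L * \<kappa> powr (- 1 / 2 - \<beta>))\<^sup>2) + n * (\<kappa> powr (- 1 / 2 - \<alpha>))\<^sup>2
      \<le> c0 * \<kappa> powr \<gamma>" .
  have 2: "c0 * (C * n powr (1 / a)) powr \<gamma> \<le> c0 * \<kappa> powr \<gamma>"
    using pos \<kappa> \<gamma> c0_pos by (intro mult_left_mono powr_mono2) auto
  have "(L / 2 * \<kappa> powr (\<alpha> - \<beta>)) powr p = 4 * p * c0 * \<kappa> powr \<gamma>"
    using pos unfolding c0
    by (subst powr_mult) (simp_all add: powr_powr \<gamma>_def mult.commute)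
  hence "(L / 2 * \<kappa> powr (\<alpha> - \<beta>)) powr p / (2 * p) = 2 * (c0 * \<kappa> powr \<gamma>)"
    using pos by simp
  thus ?thesis using 1 2 unfolding \<gamma>_def by linarith
qed

section \<open>The slow rate at the boundary sequence\<close>

theorem theorem2:
  fixes p L \<alpha> \<beta> :: real
  assumes "0 < p" "p \<le> 1" "0 < L" "0 < \<beta>" "\<beta> < \<alpha>"
  shows "\<exists>f0 \<in> hyperrectangle \<beta> L.
    \<forall>\<rho>. 0 < \<rho> \<and> \<rho> \<le> 1 \<longrightarrow>
      (\<exists>m0>0. \<forall>m. 0 < m \<and> m \<le> m0 \<longrightarrow>
        (\<lambda>n. LINT X|gauss_seq n f0.
           rho_posterior (prior p \<alpha>) \<rho> n X
             {f \<in> ell2. ell2_norm (\<lambda>k. f k - f0 k) < m * rate p \<alpha> \<beta> n})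
        \<longlonglongrightarrow> 0)"
proof -
  \<comment> \<open>The cutoff is \<open>n powr (1 / a)\<close> and the rate is
    \<open>n powr (- \<beta> / a)\<close>.\<close>
  define a where "a = 2 * \<beta> + p * (\<alpha> - \<beta>) + 1"
  define \<gamma> where "\<gamma> = p * (\<alpha> - \<beta>)"
  \<comment> \<open>With this value the halved tail exponent of the prior equals
    \<open>2 * c0\<close> times \<open>\<kappa> powr \<gamma>\<close>, and \<open>C\<close> solves
    \<open>(2 * L^2 + 1) * C powr (- a) = c0\<close>.\<close>
  define c0 where "c0 = (L / 2) powr p / (4 * p)"
  define C where "C = ((2 * L\<^sup>2 + 1) / c0) powr (1 / a)"
  \<comment> \<open>The added 1 absorbs the rounding of the cutoff to an integer.\<close>
  define D where "D = C + 1"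
  \<comment> \<open>The factor \<open>L / 4\<close> makes the squared radius fit
    \<open>card J * d^2 / 8\<close>, with \<open>d\<close> the smallest signal coordinate in the
    block. Nothing here depends on \<rho>.\<close>
  define m0 where "m0 = L / 4 * (2 * D) powr (- \<beta>)"
  define f0 where "f0 = (\<lambda>k. L * real (Suc k) powr (- 1 / 2 - \<beta>))"
  define \<sigma> where "\<sigma> = (\<lambda>k. real (Suc k) powr (- 1 / 2 - \<alpha>))"
  define H where "H = density lborel (\<lambda>t. ennreal (h_dens p t))"
  define h where "h = measure H {0..1}"
  have a: "0 < a" using assms by (simp add: a_def add_pos_pos)
  have \<gamma>: "0 < \<gamma>" using assms by (simp add: \<gamma>_def)
  have c0: "0 < c0" using assms by (simp add: c0_def)
  have L2: "0 < 2 * L\<^sup>2 + 1" by (simp add: add_nonneg_pos)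
  have C: "0 < C" using c0 L2 by (simp add: C_def)
  have C_a: "(2 * L\<^sup>2 + 1) * C powr (- a) \<le> c0"
    using a c0 L2 by (simp add: C_def powr_powr powr_minus)
  have D: "0 < D" using C by (simp add: D_def)
  have m0: "0 < m0" using D assms by (simp add: m0_def)
  have H: "prob_space H" unfolding H_def by (rule prob_space_h_dens) fact
  have sets_H: "sets H = sets borel" by (simp add: H_def)
  have h: "0 < h" unfolding h_def H_def by (rule h_dens_unit_interval_pos) fact
  obtain c where c: "0 < c" and tail: "\<And>T. 0 \<le> T \<Longrightarrow> measure H {T<..} \<le> c * exp (- (T powr p) / (2 * p))"
    unfolding H_def by (rule h_dens_tail[OF assms(1)]) blast
  have f0_hyp: "f0 \<in> hyperrectangle \<beta> L"
    unfolding f0_def by (rule powr_sequence_in_hyperrectangle) fact+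
  hence f0: "f0 \<in> ell2" by (simp add: hyperrectangle_def)
  have \<sigma>: "0 < \<sigma> k" for k by (simp add: \<sigma>_def)
  have prior: "prior p \<alpha> = distr (PiM UNIV (\<lambda>_. H)) (PiM UNIV (\<lambda>_. borel)) (\<lambda>\<zeta> k. \<sigma> k * \<zeta> k)"
    by (simp add: prior_def H_def \<sigma>_def)
  \<comment> \<open>The margin of \<open>exponent_balance\<close> at the cutoff; its divergence
    drives the limit.\<close>
  define A where "A = (\<lambda>n::nat. c0 * (C * real n powr (1 / a)) powr \<gamma>)"
  show ?thesis
  proof (intro bexI[OF _ f0_hyp] allI impI exI[of _ m0] conjI m0)
    fix \<rho> m :: real
    assume \<rho>: "0 < \<rho> \<and> \<rho> \<le> 1" and m: "0 < m \<and> m \<le> m0"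
    let ?B = "\<lambda>n. {f \<in> ell2. ell2_norm (\<lambda>k. f k - f0 k) < m * rate p \<alpha> \<beta> n}"
    let ?u = "\<lambda>n. LINT X|gauss_seq n f0. rho_posterior (prior p \<alpha>) \<rho> n X (?B n)"
    have upper: "?u n \<le> 8 / A n + 2 * (c / h) * exp (- A n / 2)" if n: "0 < n" for n
    proof -
      define N where "N = nat \<lceil>C * real n powr (1 / a)\<rceil>"
      \<comment> \<open>Indices start at 0, so the block carries the coordinate numbers
        \<open>N + 1\<close> to \<open>2 * N\<close>: all lie above the cutoff, and all signal
        coordinates in it are of the same order.\<close>
      define J where "J = {N..<2 * N}"
      define R where "R = (\<lambda>X k. 4 * (real n * (X k - f0 k)\<^sup>2) / A n + c / h * exp (- A n / 2))"
      have n1: "1 \<le> real n powr (1 / a)" using n a by (simp add: ge_one_powr_ge_zero)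
      have N_ge: "C * real n powr (1 / a) \<le> real N"
        unfolding N_def by (rule real_nat_ceiling_ge)
      have "0 < C * real n powr (1 / a)" using C n by simp
      hence N: "0 < N" using N_ge by linarith
      have "real N \<le> C * real n powr (1 / a) + 1"
        unfolding N_def using C by (simp add: of_nat_nat)
      hence N_le: "real N \<le> D * real n powr (1 / a)"
        using n1 by (simp add: D_def algebra_simps)
      have A: "0 < A n" using c0 C n by (simp add: A_def)
      have J: "finite J" "card J = N" by (simp_all add: J_def)
      have R: "0 \<le> R X k" for X k using A c h by (simp add: R_def)
      have half: "f \<in> ell2 \<and> real N / 2 \<le> (\<Sum>k\<in>J. indicator {f. f0 k / 2 < f k} f)" if "f \<in> ?B n" for f
      proof
        show "f \<in> ell2" using that by simp
        let ?d = "L * real (2 * N) powr (- 1 / 2 - \<beta>)"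
        have "real (card J) / 2 \<le> (\<Sum>k\<in>J. indicator {f. f0 k / 2 < f k} f)"
        proof (rule half_of_large_coordinates[where r = "m * rate p \<alpha> \<beta> n" and d = ?d])
          show "f \<in> ell2" "ell2_norm (\<lambda>k. f k - f0 k) < m * rate p \<alpha> \<beta> n" using that by simp_all
          show "0 < ?d" using N assms by simp
          show "?d \<le> f0 k" if "k \<in> J" for k
            unfolding f0_def using that assms N
            by (intro mult_left_mono powr_mono2') (auto simp: J_def)
          have "m * rate p \<alpha> \<beta> n \<le> m0 * real n powr (- \<beta> / a)"
            unfolding rate_def a_def using m by (intro mult_right_mono) auto
          also have "\<dots> = L / 4 * (2 * (D * real n powr (1 / a))) powr (- \<beta>)"
            using D n by (simp add: m0_def powr_mult powr_powr mult.assoc[symmetric])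
          also have "\<dots> \<le> L / 4 * (2 * real N) powr (- \<beta>)"
            using N_le N assms by (intro mult_left_mono powr_mono2') auto
          finally have "(m * rate p \<alpha> \<beta> n)\<^sup>2 \<le> (L / 4 * (2 * real N) powr (- \<beta>))\<^sup>2"
            using m by (intro power_mono) (auto simp: rate_def)
          \<comment> \<open>The factor \<open>N\<close> cancels the part \<open>- 1\<close> of the
            exponent in \<open>?d^2\<close>; both sides equal
            \<open>L^2 / 16 * (2 * N) powr (- 2 * \<beta>)\<close>.\<close>
          also have "\<dots> = real N * ?d\<^sup>2 / 8"
          proof -
            have "real (2 * N) * (real (2 * N) powr (- 1 / 2 - \<beta>))\<^sup>2
                = real (2 * N) powr (1 + ((- 1 / 2 - \<beta>) + (- 1 / 2 - \<beta>)))"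
              using N by (simp only: powr_add power2_eq_square) simp
            also have "1 + ((- 1 / 2 - \<beta>) + (- 1 / 2 - \<beta>)) = - \<beta> + - \<beta>" by simp
            also have "real (2 * N) powr (- \<beta> + - \<beta>) = (real (2 * N) powr (- \<beta>))\<^sup>2"
              by (simp only: powr_add power2_eq_square)
            finally show ?thesis by (simp add: power_mult_distrib power_divide)
          qed
          finally show "(m * rate p \<alpha> \<beta> n)\<^sup>2 \<le> real (card J) * ?d\<^sup>2 / 8" by (simp only: J)
        qed (fact f0 J)+
        thus "real N / 2 \<le> (\<Sum>k\<in>J. indicator {f. f0 k / 2 < f k} f)" by (simp only: J)
      qed
      have coord: "(\<integral>\<^sup>+ f. ennreal (exp (\<rho> * loglik n f X)) * indicator (ell2 \<inter> {f. f0 k / 2 < f k}) f \<partial>prior p \<alpha>)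
          \<le> ennreal (R X k) * (\<integral>\<^sup>+ f. ennreal (exp (\<rho> * loglik n f X)) * indicator ell2 f \<partial>prior p \<alpha>)"
        if k: "k \<in> J" for X k
        unfolding R_def prior h_def
      proof (rule coordinate_tail_le[OF H sets_H])
        let ?\<kappa> = "real (Suc k)"
        let ?T = "L / 2 * ?\<kappa> powr (\<alpha> - \<beta>)"
        \<comment> \<open>Dividing by the prior scale turns the event for coordinate
          \<open>k\<close> into the event that a draw from \<open>H\<close> exceeds
          \<open>?T\<close>.\<close>
        have "?\<kappa> powr (\<alpha> - \<beta>) * ?\<kappa> powr (- 1 / 2 - \<alpha>) = ?\<kappa> powr (- 1 / 2 - \<beta>)"
          unfolding powr_add[symmetric] by (rule arg_cong2[where f = "(powr)"]) simp_all
        hence "f0 k / 2 = ?T * \<sigma> k"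
          by (simp only: f0_def \<sigma>_def mult.assoc)
        hence "f0 k / 2 < \<sigma> k * t \<longleftrightarrow> ?T < t" for t
          using mult_less_cancel_right_pos[OF \<sigma>[of k], of ?T t] by (simp only: mult.commute[of "\<sigma> k" t])
        hence "{t. f0 k / 2 < \<sigma> k * t} = {?T<..}"
          by (simp only: greaterThan_def)
        thus "measure H {t. f0 k / 2 < \<sigma> k * t} \<le> c * exp (- (?T powr p / (2 * p)))"
          using tail[of ?T] assms by simp
        show "2 * (real n * (f0 k)\<^sup>2) + real n * (\<sigma> k)\<^sup>2 + A n \<le> ?T powr p / (2 * p)"
          unfolding f0_def \<sigma>_def A_def \<gamma>_def a_def
        proof (rule exponent_balance)
          show "C * real n powr (1 / (2 * \<beta> + p * (\<alpha> - \<beta>) + 1)) \<le> ?\<kappa>"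
            using N_ge k by (simp add: J_def a_def[symmetric])
          show "(2 * L\<^sup>2 + 1) * C powr - (2 * \<beta> + p * (\<alpha> - \<beta>) + 1) \<le> c0"
            using C_a by (simp add: a_def)
          show "4 * p * c0 = (L / 2) powr p" using assms by (simp add: c0_def)
        qed (use assms C n in auto)
      qed (use \<rho> \<sigma>[of k] h c A in \<open>auto simp: h_def\<close>)
      interpret G: prob_space "gauss_seq n f0" by (rule gauss_seq_coordinate[OF n])
      have int_R: "integrable (gauss_seq n f0) (\<lambda>X. R X k)" for k
        unfolding R_def using gauss_seq_coordinate(1)[OF n, of f0 k] by auto
      have post: "rho_posterior (prior p \<alpha>) \<rho> n X (?B n) \<le> (\<Sum>k\<in>J. R X k) / (real N / 2)" for X
      proof (rule rho_posterior_le[where F = "\<lambda>k. f0 k / 2"])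
        show "sets (prior p \<alpha>) = sets (PiM UNIV (\<lambda>_. borel))" by (simp add: prior)
        show "0 < real N / 2" using N by simp
      qed (erule half | erule coord | rule R J)+
      have "?u n \<le> (LINT X|gauss_seq n f0. (\<Sum>k\<in>J. R X k) / (real N / 2))"
      \<comment> \<open>Only the upper bound has to be integrable: a non-integrable posterior
        probability has integral 0, which the nonnegative bound covers.\<close>
      proof (rule integral_mono')
        show "integrable (gauss_seq n f0) (\<lambda>X. (\<Sum>k\<in>J. R X k) / (real N / 2))"
          by (intro integrable_divide Bochner_Integration.integrable_sum int_R)
        show "0 \<le> (\<Sum>k\<in>J. R X k) / (real N / 2)" for X
          by (intro divide_nonneg_nonneg sum_nonneg R) simp_all
      qed (rule post)
      also have "\<dots> = (\<Sum>k\<in>J. 4 / A n + c / h * exp (- A n / 2)) / (real N / 2)"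
      proof -
        have "(LINT X|gauss_seq n f0. R X k) = 4 / A n + c / h * exp (- A n / 2)" for k
          unfolding R_def using gauss_seq_coordinate(1,2)[OF n, of f0 k] n
          by (subst Bochner_Integration.integral_add) (auto simp: G.prob_space)
        thus ?thesis using int_R by (simp add: Bochner_Integration.integral_sum)
      qed
      \<comment> \<open>All \<open>N\<close> summands are equal and the divisor is
        \<open>N / 2\<close>, so the block size cancels up to a factor 2.\<close>
      also have "\<dots> = 8 / A n + 2 * (c / h) * exp (- A n / 2)"
        using N by (simp add: J field_simps)
      finally show ?thesis .
    qed
    have lower: "0 \<le> ?u n" for n
      unfolding rho_posterior_def set_lebesgue_integral_def
      by (intro Bochner_Integration.integral_nonneg divide_nonneg_nonneg) auto
    have "filterlim A at_top sequentially"
      unfolding A_def using c0 C a \<gamma> by real_asymp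
    moreover have "((\<lambda>x::real. 8 / x + 2 * (c / h) * exp (- x / 2)) \<longlongrightarrow> 0) at_top"
      by real_asymp
    ultimately have lim: "(\<lambda>n. 8 / A n + 2 * (c / h) * exp (- A n / 2)) \<longlonglongrightarrow> 0"
      by (rule filterlim_compose[rotated])
    have ev: "\<forall>\<^sub>F n in sequentially. ?u n \<le> 8 / A n + 2 * (c / h) * exp (- A n / 2)"
      by (rule eventually_sequentiallyI[of 1]) (rule upper, simp)
    show "?u \<longlonglongrightarrow> 0"
      by (rule tendsto_sandwich[OF always_eventually[OF allI] ev tendsto_const lim]) (rule lower)
  qed
qed

end
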